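(* Let $G$ be an additive abelian group whose torsion subgroup is cyclic. Let $h,k,l,m,n$ be positive integers satisfying $k-1\ge m(n-1)$ and $l-1\ge h(n-1)$. Assume that $c_1,\ldots,c_n\in G$ are distinct, and that $A_1,\ldots,A_n,B_1,\ldots,B_n$ are subsets of $G$ with $|A_1|=\cdots=|A_n|=k$ and $|B_1|=\cdots=|B_n|=l$. Then, for any sets $S$ and $T$ with $|S|\le (k-1)n-(m+1)\binom n2$ and $|T|\le (l-1)n-(h+1)\binom n2$, there are $a_1\in A_1,\ldots,a_n\in A_n,\ b_1\in B_1,\ldots,b_n\in B_n$ such that $\{a_1,\ldots,a_n\}\notin S$, $\{b_1,\ldots,b_n\}\notin T$, and also $$a_i+b_i+c_i\ne a_j+b_j+c_j,\quad ma_i\ne ma_j,\quad hb_i\ne hb_j\quad\text{whenever } 1\le i<j\le n.$$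
   Context: The torsion subgroup of $G$ is the set of elements of finite order. Here $S$ and $T$ are sets whose relevant members are subsets of $G$: the condition $\{a_1,\ldots,a_n\}\notin S$ means that the (unordered) set $\{a_1,\ldots,a_n\}$ is not an element of $S$. *)

theory Defs
  imports "HOL-Algebra.Algebra"
begin

text \<open>
  HOL-Algebra writes abelian groups multiplicatively: the sum of \<open>x\<close> and \<open>y\<close> is
  \<open>x \<otimes>\<^bsub>G\<^esub> y\<close>, and the \<open>m\<close>-fold multiple of \<open>x\<close> is \<open>x [^]\<^bsub>G\<^esub> m\<close>.
\<close>

definition torsion_subgroup :: "('a, 'b) monoid_scheme \<Rightarrow> 'a set" where
  "torsion_subgroup G = {x \<in> carrier G. \<exists>d::nat. d > 0 \<and> x [^]\<^bsub>G\<^esub> d = \<one>\<^bsub>G\<^esub>}"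

lemma (in comm_group) torsion_subgroup_is_subgroup: "subgroup (torsion_subgroup G) G"
proof
  show "torsion_subgroup G \<subseteq> carrier G" and "\<one> \<in> torsion_subgroup G"
    by (auto simp: torsion_subgroup_def)
next
  fix x y
  assume "x \<in> torsion_subgroup G" "y \<in> torsion_subgroup G"
  then obtain d e :: nat where x: "x \<in> carrier G" "d > 0" "x [^] d = \<one>"
    and y: "y \<in> carrier G" "e > 0" "y [^] e = \<one>"
    by (auto simp: torsion_subgroup_def)
  have "x [^] (d * e) = \<one>"
    using x nat_pow_pow [of x d e] by simp
  moreover have "y [^] (d * e) = \<one>"
    using y nat_pow_pow [of y e d] by (simp add: mult.commute)
  ultimately have "(x \<otimes> y) [^] (d * e) = \<one>"
    using x y by (simp add: nat_pow_distrib)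
  then show "x \<otimes> y \<in> torsion_subgroup G"
    using x y unfolding torsion_subgroup_def by (auto intro!: exI [of _ "d * e"])
next
  fix x
  assume "x \<in> torsion_subgroup G"
  then show "inv x \<in> torsion_subgroup G"
    by (auto simp: torsion_subgroup_def nat_pow_inv)
qed

end

theory Submission
  imports Defs "Jordan_Normal_Form.Determinant" "HOL-Analysis.Continuum_Not_Denumerable"
begin

text \<open>
  As the torsion subgroup is cyclic, the finitely generated subgroup containing the given data
  embeds into the multiplicative group of the complex numbers, so all data may be taken to be
  complex numbers. Consider the polynomial
  \<open>det ((c i * x i * y i) ^ j) * det (x i ^ (m * j)) * det (y i ^ (h * j)) *
  (\<Prod>s. (\<Sum>i. x i) - s) * (\<Prod>t. (\<Sum>i. y i) - t)\<close>, where \<open>s\<close> and \<open>t\<close> run over the element sums of the members of \<open>S\<close> and \<open>T\<close>, padded to lists of the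
  maximal admissible lengths \<open>K\<close> and \<open>L\<close>. It vanishes at every choice of the \<open>a\<close> and \<open>b\<close> violating
  the conclusion. Expanding the first determinant over permutations, the coefficient of
  \<open>\<Prod>i. x i ^ (k - 1) * y i ^ (l - 1)\<close> is \<open>\<Sum>p. sgn p * (\<Prod>i. c i ^ p i) * X p * Y p\<close>, where
  \<open>X p = sgn p * K! * det (1 / (k - 1 - i - m * j)!)\<close> and similarly for \<open>Y p\<close>. The signs cancel
  in \<open>X p * Y p\<close>, which leaves a nonzero multiple of the Vandermonde determinant of \<open>c\<close>. By the
  Combinatorial Nullstellensatz the polynomial does not vanish on the grid.
\<close>

section \<open>Weighted sums over grids\<close>

text \<open>Product weights make this linear functional factor over the coordinates on products of
  one-variable functions. A nonzero value yields a grid point where \<open>f\<close> does not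
  vanish.\<close>

definition grid_sum :: "nat \<Rightarrow> (nat \<Rightarrow> 'a set) \<Rightarrow> (nat \<Rightarrow> 'a \<Rightarrow> 'b) \<Rightarrow> ((nat \<Rightarrow> 'a) \<Rightarrow> 'b) \<Rightarrow> 'b::comm_semiring_1"
  where "grid_sum n A w f = (\<Sum>x\<in>PiE {0..<n} A. (\<Prod>i = 0..<n. w i (x i)) * f x)"

lemma grid_sum_diff:
  "grid_sum n A w (\<lambda>x. f x - g x :: 'a::comm_ring_1) = grid_sum n A w f - grid_sum n A w g"
  by (simp add: grid_sum_def right_diff_distrib sum_subtractf)

lemma grid_sum_cmult: "grid_sum n A w (\<lambda>x. c * f x) = c * grid_sum n A w f"
  by (simp add: grid_sum_def sum_distrib_left ac_simps)

lemma grid_sum_sum: "grid_sum n A w (\<lambda>x. \<Sum>i\<in>I. f i x) = (\<Sum>i\<in>I. grid_sum n A w (f i))"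
  unfolding grid_sum_def sum_distrib_left by (rule sum.swap)

lemma grid_sum_prod:
  assumes "\<And>i. i < n \<Longrightarrow> finite (A i)"
  shows "grid_sum n A w (\<lambda>x. \<Prod>i = 0..<n. f i (x i)) = (\<Prod>i = 0..<n. \<Sum>a\<in>A i. w i a * f i a)"
proof -
  have "(\<Prod>i = 0..<n. \<Sum>a\<in>A i. w i a * f i a)
      = (\<Sum>x\<in>PiE {0..<n} A. \<Prod>i = 0..<n. w i (x i) * f i (x i))"
    using assms by (intro prod_sum_PiE) auto
  then show ?thesis
    by (simp add: grid_sum_def prod.distrib)
qed

section \<open>Interpolation weights in one variable\<close>

definition top_coeff_weights :: "'a::field set \<Rightarrow> ('a \<Rightarrow> 'a) \<Rightarrow> bool" where
  "top_coeff_weights A w \<longleftrightarrow>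
     (\<forall>j < card A. (\<Sum>a\<in>A. w a * a ^ j) = (if j = card A - 1 then 1 else 0))"

text \<open>These are the Lagrange weights, the reciprocals of the products of \<open>a - b\<close>
  over the other points \<open>b\<close>, so the weighted sum is a divided difference. The induction
  divides the old weights by \<open>a - c\<close>.\<close>

lemma top_coeff_weights_exist:
  assumes "finite A" "A \<noteq> {}"
  shows "\<exists>w. top_coeff_weights A w"
  using assms
proof (induction rule: finite_ne_induct)
  case (singleton a)
  show ?case by (rule exI [of _ "\<lambda>_. 1"]) (simp add: top_coeff_weights_def)
next
  case (insert c A)
  then obtain w where w: "\<And>j. j < card A \<Longrightarrow> (\<Sum>a\<in>A. w a * a ^ j) = (if j = card A - 1 then 1 else 0)"
    by (auto simp: top_coeff_weights_def)
  \<comment> \<open>The value at \<open>c\<close> makes the total weight zero, the base case for the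
    vanishing moments.\<close>
  define w' where "w' = (\<lambda>a. if a = c then - (\<Sum>a\<in>A. w a / (a - c)) else w a / (a - c))"
  define s where "s = (\<lambda>j. \<Sum>a\<in>insert c A. w' a * a ^ j)"
  have s_insert: "s j = w' c * c ^ j + (\<Sum>a\<in>A. w a / (a - c) * a ^ j)" for j
  proof -
    have "(\<Sum>a\<in>A. w' a * a ^ j) = (\<Sum>a\<in>A. w a / (a - c) * a ^ j)"
      using insert.hyps by (intro sum.cong) (auto simp: w'_def)
    then show ?thesis using insert.hyps by (simp add: s_def)
  qed
  \<comment> \<open>Writing \<open>a = c + (a - c)\<close> gives a recursion for the new moments
    driven by the old ones, which are 0 until the last one equals 1.\<close>
  have step: "s (Suc j) = c * s j + (\<Sum>a\<in>A. w a * a ^ j)" for j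
  proof -
    have "w a / (a - c) * a ^ Suc j = c * (w a / (a - c) * a ^ j) + w a * a ^ j" if "a \<in> A" for a
    proof -
      have "a - c \<noteq> 0" using that insert by auto
      then show ?thesis by (simp add: divide_simps) (simp add: algebra_simps)
    qed
    then have "(\<Sum>a\<in>A. w a / (a - c) * a ^ Suc j)
        = c * (\<Sum>a\<in>A. w a / (a - c) * a ^ j) + (\<Sum>a\<in>A. w a * a ^ j)"
      by (simp add: sum_distrib_left flip: sum.distrib)
    then show ?thesis
      unfolding s_insert by (simp add: algebra_simps)
  qed
  have zero: "s j = 0" if "j < card A" for j
    using that
  proof (induction j)
    case 0
    show ?case unfolding s_insert by (simp add: w'_def)
  next
    case (Suc j)
    then show ?case by (simp add: step w)
  qed
  obtain r where r: "card A = Suc r"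
    using insert by (metis card_0_eq not0_implies_Suc)
  have "s (card A) = 1"
    unfolding r step using w [of r] zero [of r] r by simp
  then have "top_coeff_weights (insert c A) w'"
    unfolding top_coeff_weights_def using insert zero
    by (auto simp: s_def less_Suc_eq)
  then show ?case by blast
qed

section \<open>Reciprocal factorials and multinomial coefficients\<close>

definition inv_fact :: "int \<Rightarrow> 'a::field_char_0" where
  "inv_fact t = (if t < 0 then 0 else 1 / fact (nat t))"

lemma inv_fact_0 [simp]: "inv_fact 0 = 1"
  and inv_fact_neg [simp]: "t < 0 \<Longrightarrow> inv_fact t = 0"
  by (simp_all add: inv_fact_def)

text \<open>Vanishing at negative integers, as for the reciprocal Gamma function, frees the
  recursion from sign conditions: at \<open>t = 0\<close> both sides are 0.\<close>

lemma inv_fact_diff_1: "inv_fact (t - 1) = of_int t * inv_fact t"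
proof (cases "t \<le> 0")
  case False
  then obtain r where "t = int (Suc r)"
    by (metis not_le zero_less_imp_eq_int gr0_implies_Suc)
  then have "t = int r + 1" by simp
  then show ?thesis
    by (simp add: inv_fact_def divide_simps nat_add_distrib add.commute)
       (metis of_nat_Suc of_nat_neq_0)
qed (auto simp: inv_fact_def)

lemma inv_fact_diff_nat:
  "inv_fact (int t - int i) = inv_fact (int t) * (\<Prod>r<i. of_nat t - of_nat r :: 'a::field_char_0)"
proof (induction i)
  case (Suc i)
  have "inv_fact (int t - int (Suc i)) = (inv_fact (int t - int i - 1) :: 'a)"
    by (simp add: algebra_simps)
  also have "\<dots> = of_int (int t - int i) * inv_fact (int t - int i)"
    by (rule inv_fact_diff_1)
  also have "\<dots> = (of_nat t - of_nat i) * (inv_fact (int t) * (\<Prod>r<i. of_nat t - of_nat r))"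
    by (simp only: Suc.IH of_int_diff of_int_of_nat_eq)
  finally show ?case by (simp only: prod.lessThan_Suc mult_ac)
qed simp

text \<open>
  With these weights \<open>grid_sum\<close> extracts the coefficient of \<open>\<Prod>i. x i ^ (k - 1)\<close> from any
  polynomial of total degree at most \<open>n * (k - 1)\<close>: every other monomial of such degree has
  some exponent below \<open>k - 1\<close> and is annihilated.
\<close>

lemma grid_sum_monomial:
  fixes A :: "nat \<Rightarrow> 'a::field_char_0 set"
  assumes A: "\<And>i. i < n \<Longrightarrow> finite (A i) \<and> card (A i) = k \<and> top_coeff_weights (A i) (w i)"
    and k: "k > 0" and e: "(\<Sum>i = 0..<n. e i) \<le> n * (k - 1)"
  shows "grid_sum n A w (\<lambda>x. \<Prod>i = 0..<n. x i ^ e i)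
    = (if (\<Sum>i = 0..<n. e i) = n * (k - 1) then \<Prod>i = 0..<n. inv_fact (int k - 1 - int (e i)) else 0)"
proof -
  have prod: "grid_sum n A w (\<lambda>x. \<Prod>i = 0..<n. x i ^ e i) = (\<Prod>i = 0..<n. \<Sum>a\<in>A i. w i a * a ^ e i)"
    using A by (intro grid_sum_prod) auto
  have w: "(\<Sum>a\<in>A i. w i a * a ^ j) = (if j = k - 1 then 1 else 0)" if "i < n" "j < k" for i j
    using A [OF that(1)] that by (auto simp: top_coeff_weights_def)
  show ?thesis
  proof (cases "\<forall>i<n. e i = k - 1")
    case True
    then show ?thesis unfolding prod using k w by (auto intro!: prod.neutral)
  next
    case False
    have "\<exists>i<n. e i < k - 1"
    proof (rule ccontr)
      assume "\<not> ?thesis"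
      then have ge: "\<And>i. i < n \<Longrightarrow> k - 1 \<le> e i" by force
      from False obtain i where "i < n" "k - 1 < e i" using ge by force
      then have "(\<Sum>i = 0..<n. k - 1) < (\<Sum>i = 0..<n. e i)"
        using ge by (intro sum_strict_mono_ex1) auto
      with e show False by simp
    qed
    then obtain i where i: "i < n" "e i < k - 1" by blast
    then have L: "(\<Prod>i = 0..<n. \<Sum>a\<in>A i. w i a * a ^ e i) = 0"
      using w [of i "e i"] by (intro prod_zero) (auto intro!: bexI [of _ i])
    \<comment> \<open>At the critical total degree, an exponent below \<open>k - 1\<close> forces
      another above it, where \<open>inv_fact\<close> is 0. The product of reciprocal factorials
      thus acts as the indicator of all exponents being \<open>k - 1\<close>.\<close>
    have R: "(\<Prod>i = 0..<n. inv_fact (int k - 1 - int (e i))) = (0::'a)"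
      if "(\<Sum>i = 0..<n. e i) = n * (k - 1)"
    proof -
      have "\<exists>j<n. k - 1 < e j"
      proof (rule ccontr)
        assume "\<not> ?thesis"
        then have "e j \<le> k - 1" if "j < n" for j
          using that not_less by blast
        then have "(\<Sum>i = 0..<n. e i) < (\<Sum>i = 0..<n. k - 1)"
          using i by (intro sum_strict_mono_ex1) auto
        with that show False by simp
      qed
      then obtain j where "j < n" "k - 1 < e j" by blast
      then show ?thesis using k by (intro prod_zero) (auto intro!: bexI [of _ j])
    qed
    show ?thesis unfolding prod L using R by simp
  qed
qed

text \<open>The constants \<open>s\<close> only produce monomials of lower degree, so at the
  critical degree the value is the multinomial coefficient from a power of the sum of the variables.
  The induction splits one linear factor into its variables and its constant.\<close>

lemma grid_sum_monomial_linear_factors: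
  fixes A :: "nat \<Rightarrow> 'a::field_char_0 set"
  assumes A: "\<And>i. i < n \<Longrightarrow> finite (A i) \<and> card (A i) = k \<and> top_coeff_weights (A i) (w i)"
    and k: "k > 0" and e: "(\<Sum>i = 0..<n. e i) + length ss \<le> n * (k - 1)"
  shows "grid_sum n A w (\<lambda>x. (\<Prod>i = 0..<n. x i ^ e i) * (\<Prod>s\<leftarrow>ss. (\<Sum>i = 0..<n. x i) - s))
    = (if (\<Sum>i = 0..<n. e i) + length ss = n * (k - 1)
       then fact (length ss) * (\<Prod>i = 0..<n. inv_fact (int k - 1 - int (e i))) else 0)"
  using e
proof (induction ss arbitrary: e)
  case Nil
  then show ?case using grid_sum_monomial [OF A k, where e = e] by simp
next
  case (Cons s ss)
  let ?L = "\<lambda>x. \<Prod>s\<leftarrow>ss. (\<Sum>i = 0..<n. x i) - s"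
  let ?N = "n * (k - 1)"
  let ?E = "\<lambda>i. e(i := Suc (e i))"
  have mono: "(\<Prod>j = 0..<n. x j ^ ?E i j) = x i * (\<Prod>j = 0..<n. x j ^ e j)" if "i < n" for i and x :: "nat \<Rightarrow> 'a"
    using that by (simp add: prod.remove [of "{0..<n}" i] cong: prod.cong_simp)
  have sum_E: "(\<Sum>j = 0..<n. ?E i j) = Suc (\<Sum>j = 0..<n. e j)" if "i < n" for i
    using that by (simp add: sum.remove [of "{0..<n}" i] cong: sum.cong_simp)
  have "(\<Prod>i = 0..<n. x i ^ e i) * (\<Prod>s\<leftarrow>s # ss. (\<Sum>i = 0..<n. x i) - s)
      = (\<Sum>i = 0..<n. (\<Prod>j = 0..<n. x j ^ ?E i j) * ?L x) - s * ((\<Prod>i = 0..<n. x i ^ e i) * ?L x)" for x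
  proof -
    have "(\<Sum>i = 0..<n. (\<Prod>j = 0..<n. x j ^ ?E i j) * ?L x) = (\<Sum>i = 0..<n. x i * (\<Prod>j = 0..<n. x j ^ e j) * ?L x)"
      using mono by (intro sum.cong) auto
    then show ?thesis
      by (simp add: algebra_simps sum_distrib_left sum_distrib_right)
  qed
  then have "grid_sum n A w (\<lambda>x. (\<Prod>i = 0..<n. x i ^ e i) * (\<Prod>s\<leftarrow>s # ss. (\<Sum>i = 0..<n. x i) - s))
      = (\<Sum>i = 0..<n. grid_sum n A w (\<lambda>x. (\<Prod>j = 0..<n. x j ^ ?E i j) * ?L x))
        - s * grid_sum n A w (\<lambda>x. (\<Prod>i = 0..<n. x i ^ e i) * ?L x)"
    by (simp add: grid_sum_diff grid_sum_sum grid_sum_cmult)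
  \<comment> \<open>Without the new linear factor the degree stays strictly below
    \<open>n * (k - 1)\<close>.\<close>
  also have "grid_sum n A w (\<lambda>x. (\<Prod>i = 0..<n. x i ^ e i) * ?L x) = 0"
    using Cons.prems by (subst Cons.IH) auto
  also have "(\<Sum>i = 0..<n. grid_sum n A w (\<lambda>x. (\<Prod>j = 0..<n. x j ^ ?E i j) * ?L x))
     = (\<Sum>i = 0..<n. if (\<Sum>i = 0..<n. e i) + length (s # ss) = ?N
          then fact (length ss) * (of_int (int k - 1 - int (e i)) * (\<Prod>j = 0..<n. inv_fact (int k - 1 - int (e j)))) else 0)"
  proof (intro sum.cong refl)
    fix i assume "i \<in> {0..<n}"
    then have i: "i < n" by simp
    have "(\<Prod>j = 0..<n. inv_fact (int k - 1 - int (?E i j)))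
        = inv_fact (int k - 1 - int (e i) - 1) * (\<Prod>j\<in>{0..<n} - {i}. inv_fact (int k - 1 - int (e j)) :: 'a)"
      using i by (simp add: prod.remove [of "{0..<n}" i] algebra_simps cong: prod.cong_simp)
    also have "\<dots> = of_int (int k - 1 - int (e i)) * (\<Prod>j = 0..<n. inv_fact (int k - 1 - int (e j)))"
      using i unfolding inv_fact_diff_1 by (simp add: prod.remove [of "{0..<n}" i])
    finally have "(\<Prod>j = 0..<n. inv_fact (int k - 1 - int (?E i j)))
        = of_int (int k - 1 - int (e i)) * (\<Prod>j = 0..<n. inv_fact (int k - 1 - int (e j)) :: 'a)" .
    then show "grid_sum n A w (\<lambda>x. (\<Prod>j = 0..<n. x j ^ ?E i j) * ?L x) =
       (if (\<Sum>i = 0..<n. e i) + length (s # ss) = ?N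
          then fact (length ss) * (of_int (int k - 1 - int (e i)) * (\<Prod>j = 0..<n. inv_fact (int k - 1 - int (e j)))) else 0)"
      using Cons.prems by (subst Cons.IH) (auto simp: sum_E [OF i] simp del: fun_upd_apply)
  qed
  also have "\<dots> = (if (\<Sum>i = 0..<n. e i) + length (s # ss) = ?N
       then fact (length (s # ss)) * (\<Prod>i = 0..<n. inv_fact (int k - 1 - int (e i))) else 0)"
  proof (cases "(\<Sum>i = 0..<n. e i) + length (s # ss) = ?N")
    case True
    \<comment> \<open>The factors contributed by the variables add up to the number of linear
      factors including the new one, which turns one factorial into the next.\<close>
    have "(\<Sum>i = 0..<n. int k - 1 - int (e i)) = int n * (int k - 1) - int (\<Sum>i = 0..<n. e i)"
      by (simp add: sum_subtractf algebra_simps)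
    also have "\<dots> = int (?N - (\<Sum>i = 0..<n. e i))"
      using True k by (subst of_nat_diff) auto
    also have "?N - (\<Sum>i = 0..<n. e i) = Suc (length ss)"
      using True by simp
    finally have "(\<Sum>i = 0..<n. of_int (int k - 1 - int (e i))) = (of_nat (Suc (length ss)) :: 'a)"
      by (metis of_int_sum of_int_of_nat_eq)
    then have "(\<Sum>i = 0..<n. fact (length ss) * (of_int (int k - 1 - int (e i)) * P))
        = fact (length (s # ss)) * P" for P :: 'a
      unfolding sum_distrib_left [symmetric] sum_distrib_right [symmetric] by (simp add: mult_ac)
    then show ?thesis using True by simp
  qed simp
  finally show ?case by simp
qed

section \<open>Determinants and the coefficient\<close>

lemma det_mat_Leibniz:
  "det (mat n n (\<lambda>(i, j). f i j)) = (\<Sum>p | p permutes {0..<n}. signof p * (\<Prod>i = 0..<n. f i (p i)))"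
proof -
  have "(\<Prod>i = 0..<n. mat n n (\<lambda>(i, j). f i j) $$ (i, p i)) = (\<Prod>i = 0..<n. f i (p i))"
    if "p permutes {0..<n}" for p
    using that by (intro prod.cong) (auto dest: permutes_in_image)
  then show ?thesis
    by (subst det_def' [of _ n]) (auto intro!: sum.cong)
qed

text \<open>A nonzero kernel vector gives a combination of the \<open>p j\<close> of degree below
  \<open>n\<close> with \<open>n\<close> distinct roots, hence the zero polynomial. This contradicts
  the distinct degrees of the \<open>p j\<close>.\<close>

lemma det_scaled_poly_values_nonzero:
  fixes z :: "nat \<Rightarrow> 'a::field"
  assumes z: "inj_on z {0..<n}" and w: "\<And>i. i < n \<Longrightarrow> w i \<noteq> 0"
    and p: "\<And>j. j < n \<Longrightarrow> p j \<noteq> 0 \<and> degree (p j) = j"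
  shows "det (mat n n (\<lambda>(i, j). w i * poly (p j) (z i))) \<noteq> 0"
proof
  let ?M = "mat n n (\<lambda>(i, j). w i * poly (p j) (z i))"
  assume "det ?M = 0"
  then obtain v where v: "v \<in> carrier_vec n" "v \<noteq> 0\<^sub>v n" "?M *\<^sub>v v = 0\<^sub>v n"
    using det_0_iff_vec_prod_zero_field [of ?M n] by auto
  define q where "q = (\<Sum>j = 0..<n. smult (v $ j) (p j))"
  have root: "poly q (z i) = 0" if "i < n" for i
  proof -
    have "0 = (?M *\<^sub>v v) $ i" using v(3) that by simp
    also have "\<dots> = (\<Sum>j = 0..<n. w i * poly (p j) (z i) * v $ j)"
      using that v(1) by (simp add: scalar_prod_def)
    also have "\<dots> = w i * poly q (z i)"
      by (simp add: q_def poly_sum sum_distrib_left algebra_simps)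
    finally show ?thesis using w [OF that] by simp
  qed
  have "q = 0"
  proof (cases "n = 0")
    case False
    have "degree q \<le> n - 1"
      unfolding q_def using p False by (intro degree_sum_le) (auto intro: order_trans [OF degree_smult_le])
    show ?thesis
    proof (rule ccontr)
      assume "q \<noteq> 0"
      then have "card (z ` {0..<n}) \<le> card {x. poly q x = 0}"
        using root by (intro card_mono poly_roots_finite) auto
      also have "\<dots> \<le> degree q" by (rule card_poly_roots_bound) fact
      finally show False using \<open>degree q \<le> n - 1\<close> False z by (simp add: card_image)
    qed
  qed (simp add: q_def)
  have "\<exists>j<n. v $ j \<noteq> 0"
    using v(1,2) by (metis carrier_vecD eq_vecI index_zero_vec(1,2))
  define J where "J = {j. j < n \<and> v $ j \<noteq> 0}"
  have J: "finite J" "J \<noteq> {}" using \<open>\<exists>j<n. v $ j \<noteq> 0\<close> by (auto simp: J_def)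
  \<comment> \<open>At the largest index \<open>d\<close> with nonzero entry, only
    \<open>p d\<close> contributes to the coefficient of degree \<open>d\<close>.\<close>
  define d where "d = Max J"
  have d: "d < n" "v $ d \<noteq> 0" using Max_in [OF J] by (auto simp: d_def J_def)
  have "coeff q d = (\<Sum>j = 0..<n. v $ j * coeff (p j) d)"
    by (simp add: q_def coeff_sum)
  also have "\<dots> = (\<Sum>j\<in>{d}. v $ j * coeff (p j) d)"
  proof (rule sum.mono_neutral_right)
    show "\<forall>j\<in>{0..<n} - {d}. v $ j * coeff (p j) d = 0"
    proof
      fix j assume j: "j \<in> {0..<n} - {d}"
      show "v $ j * coeff (p j) d = 0"
      proof (cases "j < d")
        case True
        then show ?thesis using p [of j] j by (simp add: coeff_eq_0)
      next
        case False
        then have "j \<notin> J" using j Max_ge [OF J(1), of j] by (auto simp: d_def)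
        then show ?thesis using j by (simp add: J_def)
      qed
    qed
  qed (use d in auto)
  finally show False using \<open>q = 0\<close> d p [of d] leading_coeff_0_iff [of "p d"] by simp
qed

lemma Vandermonde_det_nonzero:
  fixes z :: "nat \<Rightarrow> 'a::field"
  assumes "inj_on z {0..<n}"
  shows "det (mat n n (\<lambda>(i, j). z i ^ j)) \<noteq> 0"
  using det_scaled_poly_values_nonzero [OF assms, of "\<lambda>_. 1" "\<lambda>j. monom 1 j"]
  by (simp add: poly_monom degree_monom_eq)

text \<open>Equal powers would give two equal rows. This turns nonvanishing determinant factors back
  into distinctness.\<close>

lemma inj_on_if_Vandermonde_det_nonzero:
  assumes "det (mat n n (\<lambda>(i, j). z i ^ (m * j))) \<noteq> (0 :: 'a::comm_ring_1)"
  shows "inj_on (\<lambda>i. z i ^ m) {0..<n}"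
proof (rule inj_onI, rule ccontr)
  fix i j assume "i \<in> {0..<n}" "j \<in> {0..<n}" "z i ^ m = z j ^ m" "i \<noteq> j"
  moreover from this have "row (mat n n (\<lambda>(i, j). z i ^ (m * j))) i = row (mat n n (\<lambda>(i, j). z i ^ (m * j))) j"
    by (intro eq_vecI) (auto simp: power_mult)
  ultimately show False
    using det_identical_rows [of "mat n n (\<lambda>(i, j). z i ^ (m * j))" n i j] assms by simp
qed

text \<open>Up to the factorial of the number of linear factors, this is the one-sided coefficient
  belonging to the identity permutation, whose exponent in row \<open>i\<close> is
  \<open>i\<close>.\<close>

definition inv_fact_det :: "nat \<Rightarrow> nat \<Rightarrow> nat \<Rightarrow> 'a::field_char_0" where
  "inv_fact_det n k m = det (mat n n (\<lambda>(i, j). inv_fact (int k - 1 - int (i + m * j))))"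

text \<open>
  With \<open>t j = k - 1 - m * j\<close>, the reciprocal factorial of \<open>t j - i\<close> is that of \<open>t j\<close> times the
  \<open>i\<close>-th falling factorial of \<open>t j\<close>. The hypothesis keeps \<open>t j\<close> nonnegative.
\<close>

lemma inv_fact_det_nonzero:
  assumes m: "m > 0" and k: "m * (n - 1) < k"
  shows "inv_fact_det n k m \<noteq> (0 :: 'a::field_char_0)"
proof -
  define t where "t = (\<lambda>j. k - 1 - m * j)"
  \<comment> \<open>The falling factorial as a monic polynomial of degree \<open>i\<close>,
    evaluated below at the distinct points \<open>t j\<close>.\<close>
  define p :: "nat \<Rightarrow> 'a poly" where "p = (\<lambda>i. \<Prod>r<i. [:- of_nat r, 1:])"
  have t: "int k - 1 - int (i + m * j) = int (t j) - int i" and le: "m * j \<le> k - 1" if "j < n" for i j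
  proof -
    have "m * j \<le> m * (n - 1)" using that by (intro mult_le_mono2) auto
    then show "m * j \<le> k - 1" using k by linarith
    then show "int k - 1 - int (i + m * j) = int (t j) - int i"
      using k by (simp add: t_def)
  qed
  have inj: "inj_on (\<lambda>j. of_nat (t j) :: 'a) {0..<n}"
  proof (rule inj_onI)
    fix i j assume ij: "i \<in> {0..<n}" "j \<in> {0..<n}" "of_nat (t i) = (of_nat (t j) :: 'a)"
    then have "k - 1 - m * i = k - 1 - m * j" by (simp add: t_def)
    moreover have "m * i \<le> k - 1" "m * j \<le> k - 1" using ij le by auto
    ultimately have "m * i = m * j" by linarith
    then show "i = j" using m by simp
  qed
  have poly: "poly (p i) x = (\<Prod>r<i. x - of_nat r)" for i x
    by (simp add: p_def poly_prod)
  define e where "e = (\<lambda>i j. inv_fact (int k - 1 - int (i + m * j)) :: 'a)"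
  have e: "e i j = inv_fact (int (t j)) * poly (p i) (of_nat (t j))" if "j < n" for i j
    unfolding e_def t [OF that] poly by (rule inv_fact_diff_nat)
  \<comment> \<open>Transposing puts the evaluation points into the rows.\<close>
  have "transpose_mat (mat n n (\<lambda>(i, j). e i j))
      = mat n n (\<lambda>(j, i). inv_fact (int (t j)) * poly (p i) (of_nat (t j) :: 'a))"
    by (rule eq_matI) (simp_all add: e)
  then have "inv_fact_det n k m = det (mat n n (\<lambda>(j, i). inv_fact (int (t j)) * poly (p i) (of_nat (t j) :: 'a)))"
    using det_transpose [of "mat n n (\<lambda>(i, j). e i j)" n]
    unfolding inv_fact_det_def by (simp only: e_def mat_carrier)
  also have "\<dots> \<noteq> 0"
  proof (rule det_scaled_poly_values_nonzero [OF inj])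
    show "p j \<noteq> 0 \<and> degree (p j) = j" for j
      unfolding p_def by (subst degree_prod_eq_sum_degree) auto
  qed (auto simp: inv_fact_def)
  finally show ?thesis .
qed

text \<open>When the determinant is expanded, \<open>deg\<close> gives every product exactly the
  critical degree, so each contributes a multinomial coefficient. Their signed sum is
  \<open>inv_fact_det\<close> with rows permuted by \<open>p\<close>, hence the sign.\<close>

lemma grid_sum_permutation_term:
  fixes A :: "nat \<Rightarrow> 'a::field_char_0 set"
  assumes A: "\<And>i. i < n \<Longrightarrow> finite (A i) \<and> card (A i) = k \<and> top_coeff_weights (A i) (w i)"
    and k: "k > 0" and deg: "length ss + (m + 1) * (n choose 2) = n * (k - 1)"
    and p: "p permutes {0..<n}"
  shows "grid_sum n A w (\<lambda>x. (\<Prod>i = 0..<n. x i ^ p i) *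
           (det (mat n n (\<lambda>(i, j). x i ^ (m * j))) * (\<Prod>s\<leftarrow>ss. (\<Sum>i = 0..<n. x i) - s)))
       = signof p * (fact (length ss) * inv_fact_det n k m)"
proof -
  let ?P = "{p. p permutes {0..<n}}"
  let ?L = "\<lambda>x. \<Prod>s\<leftarrow>ss. (\<Sum>i = 0..<n. x i) - s"
  have sum_perm: "(\<Sum>i = 0..<n. q i) = n choose 2" if "q permutes {0..<n}" for q
    using sum.permute [OF that, of id] by (simp add: gauss_sum_nat choose_two Sum_Ico_nat o_def)
  have "(\<Prod>i = 0..<n. x i ^ p i) * (det (mat n n (\<lambda>(i, j). x i ^ (m * j))) * ?L x)
      = (\<Sum>q\<in>?P. signof q * ((\<Prod>i = 0..<n. x i ^ (p i + m * q i)) * ?L x))" for x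
    unfolding det_mat_Leibniz
    by (simp add: sum_distrib_left sum_distrib_right power_add prod.distrib algebra_simps)
  then have "grid_sum n A w (\<lambda>x. (\<Prod>i = 0..<n. x i ^ p i) * (det (mat n n (\<lambda>(i, j). x i ^ (m * j))) * ?L x))
      = (\<Sum>q\<in>?P. signof q * grid_sum n A w (\<lambda>x. (\<Prod>i = 0..<n. x i ^ (p i + m * q i)) * ?L x))"
    by (simp add: grid_sum_sum grid_sum_cmult)
  also have "\<dots> = (\<Sum>q\<in>?P. signof q * (fact (length ss) * (\<Prod>i = 0..<n. inv_fact (int k - 1 - int (p i + m * q i)))))"
  proof (intro sum.cong refl)
    fix q assume "q \<in> ?P"
    then have "(\<Sum>i = 0..<n. p i + m * q i) + length ss = n * (k - 1)"
      using deg p by (simp add: sum.distrib sum_perm flip: sum_distrib_left)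
    then show "signof q * grid_sum n A w (\<lambda>x. (\<Prod>i = 0..<n. x i ^ (p i + m * q i)) * ?L x)
       = signof q * (fact (length ss) * (\<Prod>i = 0..<n. inv_fact (int k - 1 - int (p i + m * q i))))"
      by (subst grid_sum_monomial_linear_factors [OF A k]) auto
  qed
  also have "\<dots> = fact (length ss) * det (mat n n (\<lambda>(i, j). inv_fact (int k - 1 - int (p i + m * j))))"
    unfolding det_mat_Leibniz by (simp add: sum_distrib_left algebra_simps)
  also have "mat n n (\<lambda>(i, j). inv_fact (int k - 1 - int (p i + m * j)))
      = mat n n (\<lambda>(i, j). mat n n (\<lambda>(i, j). inv_fact (int k - 1 - int (i + m * j)) :: 'a) $$ (p i, j))"
    using p by (intro eq_matI) (auto dest: permutes_in_image)
  also have "det \<dots> = signof p * inv_fact_det n k m"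
    unfolding inv_fact_det_def by (rule det_permute_rows [OF _ p]) simp
  finally show ?thesis by (simp add: algebra_simps)
qed

text \<open>The Nullstellensatz is carried out directly: the weighted sum over both grids equals the
  coefficient, so some summand is nonzero, and each factor of the polynomial there gives one
  conclusion.\<close>

lemma grid_point_nonvanishing:
  fixes A B :: "nat \<Rightarrow> 'a::field_char_0 set"
  assumes A: "\<And>i. i < n \<Longrightarrow> finite (A i) \<and> card (A i) = k"
    and B: "\<And>i. i < n \<Longrightarrow> finite (B i) \<and> card (B i) = l"
    and c: "inj_on c {0..<n}"
    and m: "m > 0" "m * (n - 1) < k" and h: "h > 0" "h * (n - 1) < l"
    and degA: "length ss + (m + 1) * (n choose 2) = n * (k - 1)"
    and degB: "length ts + (h + 1) * (n choose 2) = n * (l - 1)"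
  obtains x y where "x \<in> PiE {0..<n} A" "y \<in> PiE {0..<n} B"
    "inj_on (\<lambda>i. c i * x i * y i) {0..<n}"
    "inj_on (\<lambda>i. x i ^ m) {0..<n}" "inj_on (\<lambda>i. y i ^ h) {0..<n}"
    "(\<Sum>i = 0..<n. x i) \<notin> set ss" "(\<Sum>i = 0..<n. y i) \<notin> set ts"
proof -
  have k: "k > 0" and l: "l > 0" using m h by auto
  have "\<exists>w. top_coeff_weights (A i) w" if "i < n" for i
    using A [OF that] k by (intro top_coeff_weights_exist) auto
  then obtain u where u: "\<And>i. i < n \<Longrightarrow> top_coeff_weights (A i) (u i)" by metis
  have "\<exists>w. top_coeff_weights (B i) w" if "i < n" for i
    using B [OF that] l by (intro top_coeff_weights_exist) auto
  then obtain v where v: "\<And>i. i < n \<Longrightarrow> top_coeff_weights (B i) (v i)" by metis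
  let ?P = "{p. p permutes {0..<n}}"
  define V where "V = (\<lambda>m (x :: nat \<Rightarrow> 'a). det (mat n n (\<lambda>(i, j). x i ^ (m * j))))"
  define f where "f = (\<lambda>x. V m x * (\<Prod>s\<leftarrow>ss. (\<Sum>i = 0..<n. x i) - s))"
  define g where "g = (\<lambda>y. V h y * (\<Prod>s\<leftarrow>ts. (\<Sum>i = 0..<n. y i) - s))"
  define D :: 'a where "D = fact (length ss) * inv_fact_det n k m * (fact (length ts) * inv_fact_det n l h)"
  \<comment> \<open>Powers of products split, so for each permutation the double sum separates into
    one grid sum in \<open>x\<close> and one in \<open>y\<close>.\<close>
  have "V 1 (\<lambda>i. c i * x i * y i) * f x * g y
      = (\<Sum>p\<in>?P. signof p * (\<Prod>i = 0..<n. c i ^ p i) * ((\<Prod>i = 0..<n. x i ^ p i) * f x) * ((\<Prod>i = 0..<n. y i ^ p i) * g y))"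
    for x y
    unfolding V_def det_mat_Leibniz
    by (unfold sum_distrib_right, intro sum.cong refl) (simp add: power_mult_distrib prod.distrib mult_ac)
  then have "grid_sum n A u (\<lambda>x. grid_sum n B v (\<lambda>y. V 1 (\<lambda>i. c i * x i * y i) * f x * g y))
     = grid_sum n A u (\<lambda>x. \<Sum>p\<in>?P. signof p * (\<Prod>i = 0..<n. c i ^ p i) * ((\<Prod>i = 0..<n. x i ^ p i) * f x) *
         grid_sum n B v (\<lambda>y. (\<Prod>i = 0..<n. y i ^ p i) * g y))"
    by (simp only: grid_sum_sum grid_sum_cmult)
  also have "\<dots> = grid_sum n A u (\<lambda>x. \<Sum>p\<in>?P. (signof p * (\<Prod>i = 0..<n. c i ^ p i) *
         grid_sum n B v (\<lambda>y. (\<Prod>i = 0..<n. y i ^ p i) * g y)) * ((\<Prod>i = 0..<n. x i ^ p i) * f x))"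
    by (simp only: mult_ac)
  also have "\<dots> = (\<Sum>p\<in>?P. (signof p * (\<Prod>i = 0..<n. c i ^ p i) *
         grid_sum n B v (\<lambda>y. (\<Prod>i = 0..<n. y i ^ p i) * g y)) * grid_sum n A u (\<lambda>x. (\<Prod>i = 0..<n. x i ^ p i) * f x))"
    by (simp only: grid_sum_sum grid_sum_cmult)
  also have "\<dots> = (\<Sum>p\<in>?P. signof p * (\<Prod>i = 0..<n. c i ^ p i) * D)"
  proof (intro sum.cong refl)
    fix p assume "p \<in> ?P"
    then have p: "p permutes {0..<n}" by simp
    have "grid_sum n A u (\<lambda>x. (\<Prod>i = 0..<n. x i ^ p i) * f x) = signof p * (fact (length ss) * inv_fact_det n k m)"
      unfolding f_def V_def using A u by (intro grid_sum_permutation_term [OF _ k degA p]) auto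
    moreover have "grid_sum n B v (\<lambda>x. (\<Prod>i = 0..<n. x i ^ p i) * g x) = signof p * (fact (length ts) * inv_fact_det n l h)"
      unfolding g_def V_def using B v by (intro grid_sum_permutation_term [OF _ l degB p]) auto
    moreover have "signof p * signof p = (1 :: 'a)"
      by (metis of_int_1 of_int_mult sign_idempotent)
    ultimately show "signof p * (\<Prod>i = 0..<n. c i ^ p i) *
         grid_sum n B v (\<lambda>y. (\<Prod>i = 0..<n. y i ^ p i) * g y) * grid_sum n A u (\<lambda>x. (\<Prod>i = 0..<n. x i ^ p i) * f x)
       = signof p * (\<Prod>i = 0..<n. c i ^ p i) * D"
      by (simp add: D_def algebra_simps)
  qed
  also have "\<dots> = V 1 c * D"
    unfolding V_def det_mat_Leibniz by (simp add: sum_distrib_right)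
  also have "\<dots> \<noteq> 0"
    using Vandermonde_det_nonzero [OF c] inv_fact_det_nonzero [OF m, where 'a = 'a] inv_fact_det_nonzero [OF h, where 'a = 'a]
    by (simp add: V_def D_def)
  finally have nonzero: "grid_sum n A u (\<lambda>x. grid_sum n B v (\<lambda>y. V 1 (\<lambda>i. c i * x i * y i) * f x * g y)) \<noteq> 0" .
  obtain x where x: "x \<in> PiE {0..<n} A"
    and "(\<Prod>i = 0..<n. u i (x i)) * grid_sum n B v (\<lambda>y. V 1 (\<lambda>i. c i * x i * y i) * f x * g y) \<noteq> 0"
    using nonzero unfolding grid_sum_def [of n A u] by (rule sum.not_neutral_contains_not_neutral)
  then have "grid_sum n B v (\<lambda>y. V 1 (\<lambda>i. c i * x i * y i) * f x * g y) \<noteq> 0"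
    by (metis mult_zero_right)
  then obtain y where y: "y \<in> PiE {0..<n} B"
    and "(\<Prod>i = 0..<n. v i (y i)) * (V 1 (\<lambda>i. c i * x i * y i) * f x * g y) \<noteq> 0"
    unfolding grid_sum_def by (rule sum.not_neutral_contains_not_neutral)
  then have nz: "V 1 (\<lambda>i. c i * x i * y i) \<noteq> 0" "f x \<noteq> 0" "g y \<noteq> 0"
    by auto
  show thesis
  proof (rule that [OF x y])
    show "inj_on (\<lambda>i. c i * x i * y i) {0..<n}"
      using inj_on_if_Vandermonde_det_nonzero [of n "\<lambda>i. c i * x i * y i" 1] nz(1)
      unfolding V_def power_one_right by blast
    have "V m x \<noteq> 0" "(\<Prod>s\<leftarrow>ss. (\<Sum>i = 0..<n. x i) - s) \<noteq> 0"
      using nz(2) unfolding f_def by auto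
    then show "inj_on (\<lambda>i. x i ^ m) {0..<n}" "(\<Sum>i = 0..<n. x i) \<notin> set ss"
      using inj_on_if_Vandermonde_det_nonzero [of n x m] unfolding V_def
      by (blast, force)
    have "V h y \<noteq> 0" "(\<Prod>s\<leftarrow>ts. (\<Sum>i = 0..<n. y i) - s) \<noteq> 0"
      using nz(3) unfolding g_def by auto
    then show "inj_on (\<lambda>i. y i ^ h) {0..<n}" "(\<Sum>i = 0..<n. y i) \<notin> set ts"
      using inj_on_if_Vandermonde_det_nonzero [of n y h] unfolding V_def
      by (blast, force)
  qed
qed

section \<open>Embedding into the complex numbers\<close>

definition char_embedding :: "('a, 'b) monoid_scheme \<Rightarrow> 'a set \<Rightarrow> ('a \<Rightarrow> complex) \<Rightarrow> bool" where
  "char_embedding G H \<phi> \<longleftrightarrow> subgroup H G \<and> (\<forall>x\<in>H. \<forall>y\<in>H. \<phi> (x \<otimes>\<^bsub>G\<^esub> y) = \<phi> x * \<phi> y) \<and>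
     inj_on \<phi> H \<and> (\<forall>x\<in>H. \<phi> x \<noteq> 0)"

text \<open>For a subgroup \<open>H\<close> of an abelian group and \<open>g\<close> in the carrier,
  this is the subgroup generated by both.\<close>

definition adjoin :: "('a, 'b) monoid_scheme \<Rightarrow> 'a set \<Rightarrow> 'a \<Rightarrow> 'a set" where
  "adjoin G H g = {x \<otimes>\<^bsub>G\<^esub> g [^]\<^bsub>G\<^esub> f | x f. x \<in> H \<and> f \<in> (UNIV :: int set)}"

lemma cis_root_powi_eq_1_iff:
  assumes "N > 0"
  shows "cis (2 * pi / real N) powi f = 1 \<longleftrightarrow> int N dvd f"
proof
  assume "cis (2 * pi / real N) powi f = 1"
  then have "cos (of_int f * (2 * pi / real N)) = 1"
    by (simp add: cis_power_int complex_eq_iff)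
  then obtain q :: int where "of_int f * (2 * pi / real N) = of_int q * (2 * pi)"
    by (auto simp: cos_one_2pi_int mult_ac)
  then have "real_of_int f = real_of_int (q * int N)"
    using assms by (simp add: field_simps)
  then show "int N dvd f" by (metis dvd_triv_right of_int_eq_iff)
next
  assume "int N dvd f"
  then obtain q where "f = int N * q" by (elim dvdE)
  then have "of_int f * (2 * pi / real N) = 2 * pi * of_int q"
    using assms by simp
  then show "cis (2 * pi / real N) powi f = 1"
    by (simp add: cis_power_int)
qed

section \<open>Extending an embedding by one element\<close>

context comm_group
begin

context
  fixes H \<phi>
  assumes emb: "char_embedding G H \<phi>"
begin

lemma char_embedding_subgroup: "subgroup H G"
  and char_embedding_mult: "x \<in> H \<Longrightarrow> y \<in> H \<Longrightarrow> \<phi> (x \<otimes> y) = \<phi> x * \<phi> y"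
  and char_embedding_inj: "inj_on \<phi> H"
  and char_embedding_nonzero: "x \<in> H \<Longrightarrow> \<phi> x \<noteq> 0"
  using emb by (auto simp: char_embedding_def)

lemma char_embedding_carrier: "x \<in> H \<Longrightarrow> x \<in> carrier G"
  by (rule subgroup.mem_carrier [OF char_embedding_subgroup])

lemma char_embedding_one: "\<phi> \<one> = 1"
proof -
  have "\<one> \<in> H" by (rule subgroup.one_closed [OF char_embedding_subgroup])
  then show ?thesis
    using char_embedding_mult [of \<one> \<one>] char_embedding_nonzero [of \<one>] by simp
qed

lemma char_embedding_eq_1: "x \<in> H \<Longrightarrow> \<phi> x = 1 \<Longrightarrow> x = \<one>"
  using char_embedding_inj char_embedding_one subgroup.one_closed [OF char_embedding_subgroup]
  by (metis inj_onD)

lemma char_embedding_nat_pow: "x \<in> H \<Longrightarrow> x [^] (r::nat) \<in> H \<and> \<phi> (x [^] r) = \<phi> x ^ r"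
  by (induction r)
     (simp_all add: char_embedding_one char_embedding_mult
        subgroup.one_closed [OF char_embedding_subgroup] subgroup.m_closed [OF char_embedding_subgroup])

lemma char_embedding_inv: "x \<in> H \<Longrightarrow> \<phi> (inv x) = inverse (\<phi> x)"
proof -
  assume x: "x \<in> H"
  then have "inv x \<in> H" by (rule subgroup.m_inv_closed [OF char_embedding_subgroup])
  then have "\<phi> x * \<phi> (inv x) = 1"
    using x char_embedding_mult [of x "inv x"] char_embedding_one char_embedding_carrier by simp
  then show ?thesis by (simp add: inverse_unique)
qed

lemma char_embedding_int_pow: "x \<in> H \<Longrightarrow> \<phi> (x [^] (f::int)) = \<phi> x powi f"
proof (cases f rule: int_cases2)
  case (nonpos r)
  assume "x \<in> H"
  then show ?thesis
    using char_embedding_nat_pow [of x r] char_embedding_carrier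
    by (simp add: nonpos int_pow_neg_int char_embedding_inv power_int_minus)
qed (simp add: int_pow_int char_embedding_nat_pow)

text \<open>The extension sends \<open>g\<close> to \<open>z\<close>. Here \<open>ext\<close> makes
  it independent of how an element is written, and \<open>ker\<close> makes it injective.\<close>

lemma char_embedding_adjoin:
  assumes g: "g \<in> carrier G" and z: "z \<noteq> 0"
    and ext: "\<And>f::int. g [^] f \<in> H \<Longrightarrow> \<phi> (g [^] f) = z powi f"
    and ker: "\<And>x f. x \<in> H \<Longrightarrow> \<phi> x * z powi f = 1 \<Longrightarrow> g [^] f \<in> H"
  shows "\<exists>\<psi>. char_embedding G (adjoin G H g) \<psi>"
proof -
  note carr = char_embedding_carrier
  note H = subgroup.m_closed [OF char_embedding_subgroup] subgroup.m_inv_closed [OF char_embedding_subgroup]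
    subgroup.one_closed [OF char_embedding_subgroup]
  have mult: "(x \<otimes> g [^] e) \<otimes> (y \<otimes> g [^] f) = (x \<otimes> y) \<otimes> g [^] (e + f)"
    if "x \<in> H" "y \<in> H" for x y and e f :: int
    using that carr g by (simp add: int_pow_mult m_ac)
  have div: "(x \<otimes> g [^] e) \<otimes> inv (y \<otimes> g [^] f) = (x \<otimes> inv y) \<otimes> g [^] (e - f)"
    if "x \<in> H" "y \<in> H" for x y and e f :: int
    using that carr g by (simp add: int_pow_diff inv_mult m_ac)
  \<comment> \<open>A definite description, since an element can have several
    representations.\<close>
  define \<psi> where "\<psi> = (\<lambda>u. THE w. \<exists>x\<in>H. \<exists>f::int. u = x \<otimes> g [^] f \<and> w = \<phi> x * z powi f)"
  have \<psi>: "\<psi> (x \<otimes> g [^] f) = \<phi> x * z powi f" if x: "x \<in> H" for x f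
    unfolding \<psi>_def
  proof (rule the_equality)
    show "\<exists>y\<in>H. \<exists>e. x \<otimes> g [^] f = y \<otimes> g [^] e \<and> \<phi> x * z powi f = \<phi> y * z powi e"
      using x by blast
  next
    fix w assume "\<exists>y\<in>H. \<exists>e::int. x \<otimes> g [^] f = y \<otimes> g [^] e \<and> w = \<phi> y * z powi e"
    then obtain y and e :: int where y: "y \<in> H" "x \<otimes> g [^] f = y \<otimes> g [^] e" "w = \<phi> y * z powi e"
      by blast
    have "(x \<otimes> inv y) \<otimes> g [^] (f - e) = \<one>"
      unfolding div [OF x y(1), symmetric] using y g carr by simp
    then have eq: "g [^] (f - e) = inv (x \<otimes> inv y)"
      using x y(1) g carr by (intro inv_equality [symmetric]) (simp_all add: m_comm)
    then have "g [^] (f - e) \<in> H" using x y(1) H by simp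
    then have "z powi (f - e) = inverse (\<phi> x * inverse (\<phi> y))"
      using ext [of "f - e"] x y(1) H by (simp add: eq char_embedding_inv char_embedding_mult)
    then show "w = \<phi> x * z powi f"
      using x y(1) z char_embedding_nonzero by (simp add: y(3) power_int_diff field_simps)
  qed
  have "subgroup (adjoin G H g) G"
  proof (rule subgroupI)
    show "adjoin G H g \<subseteq> carrier G"
      using carr g by (auto simp: adjoin_def)
    show "adjoin G H g \<noteq> {}"
      using H by (auto simp: adjoin_def)
    show "inv u \<in> adjoin G H g" if u: "u \<in> adjoin G H g" for u
    proof -
      obtain x and f :: int where "x \<in> H" "u = x \<otimes> g [^] f"
        using u by (auto simp: adjoin_def)
      then have "inv u = inv x \<otimes> g [^] (- f)"
        using carr g by (simp add: inv_mult int_pow_neg)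
      then show ?thesis using \<open>x \<in> H\<close> H by (auto simp: adjoin_def)
    qed
    show "u \<otimes> v \<in> adjoin G H g" if u: "u \<in> adjoin G H g" and v: "v \<in> adjoin G H g" for u v
    proof -
      obtain x y and e f :: int where "x \<in> H" "u = x \<otimes> g [^] e" "y \<in> H" "v = y \<otimes> g [^] f"
        using u v by (auto simp: adjoin_def)
      then show ?thesis using H(1) mult [of x y e f] by (auto simp: adjoin_def)
    qed
  qed
  moreover have "\<psi> (u \<otimes> v) = \<psi> u * \<psi> v" if "u \<in> adjoin G H g" "v \<in> adjoin G H g" for u v
  proof -
    obtain x y and e f :: int where "x \<in> H" "u = x \<otimes> g [^] e" "y \<in> H" "v = y \<otimes> g [^] f"
      using \<open>u \<in> _\<close> \<open>v \<in> _\<close> by (auto simp: adjoin_def)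
    then show ?thesis
      using H z by (simp add: mult \<psi> char_embedding_mult power_int_add)
  qed
  moreover have "inj_on \<psi> (adjoin G H g)"
  proof (rule inj_onI)
    fix u v assume uv: "u \<in> adjoin G H g" "v \<in> adjoin G H g" "\<psi> u = \<psi> v"
    then obtain x y and e f :: int where *: "x \<in> H" "u = x \<otimes> g [^] e" "y \<in> H" "v = y \<otimes> g [^] f"
      by (auto simp: adjoin_def)
    \<comment> \<open>Equal values let \<open>ker\<close> place the power of \<open>g\<close> in
      \<open>H\<close>, so the quotient of \<open>u\<close> and \<open>v\<close> lies in
      \<open>H\<close>, where \<open>\<phi>\<close> is already injective.\<close>
    have 1: "\<phi> (x \<otimes> inv y) * z powi (e - f) = 1"
      using uv(3) * H z char_embedding_nonzero
      by (simp add: \<psi> char_embedding_mult char_embedding_inv power_int_diff field_simps)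
    have 2: "g [^] (e - f) \<in> H"
      using 1 by (rule ker [rotated]) (use * H in auto)
    have "\<phi> (u \<otimes> inv v) = 1"
      using * H 1 2 by (simp add: div char_embedding_mult [of _ "g [^] (e - f)"] ext)
    moreover have "u \<otimes> inv v \<in> H"
      using * H 2 by (simp add: div)
    ultimately have "u \<otimes> inv v = \<one>" by (intro char_embedding_eq_1)
    moreover have "u \<in> carrier G" "v \<in> carrier G"
      using * carr g by auto
    ultimately show "u = v"
      using inv_equality [of u "inv v"] by simp
  qed
  moreover have "\<psi> u \<noteq> 0" if "u \<in> adjoin G H g" for u
    using that z char_embedding_nonzero by (auto simp: adjoin_def \<psi>)
  ultimately show ?thesis
    unfolding char_embedding_def by blast
qed

text \<open>
  If some power of \<open>g\<close> lies in \<open>H\<close>, any root of the appropriate order keeps the extension injective: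
  a new kernel element would be torsion, hence already in \<open>H\<close>. Otherwise the image of \<open>g\<close> must avoid
  the countably many roots of values of \<open>\<phi>\<close>.
\<close>

lemma char_embedding_extend:
  assumes g: "g \<in> carrier G" and countable: "countable H" and torsion: "torsion_subgroup G \<subseteq> H"
  shows "\<exists>\<psi>. char_embedding G (adjoin G H g) \<psi>"
proof (cases "\<exists>d::nat. d > 0 \<and> g [^] d \<in> H")
  case True
  \<comment> \<open>Division with remainder will show that every \<open>f\<close> with
    \<open>g [^] f\<close> in \<open>H\<close> is a multiple of \<open>d\<close>, so prescribing
    \<open>z ^ d\<close> settles the compatibility with \<open>\<phi>\<close>.\<close>
  define d :: nat where "d = (LEAST d. d > 0 \<and> g [^] d \<in> H)"
  have d: "d > 0" "g [^] d \<in> H"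
    using LeastI_ex [OF True] by (auto simp: d_def)
  have least: "d \<le> e" if "e > 0" "g [^] e \<in> H" for e :: nat
    unfolding d_def using that by (intro Least_le) auto
  have "card {z. z ^ d = \<phi> (g [^] d)} = d"
    using d char_embedding_nonzero by (intro card_nth_roots) auto
  then have "{z. z ^ d = \<phi> (g [^] d)} \<noteq> {}"
    using d(1) by (intro notI) simp
  then obtain z where z: "z ^ d = \<phi> (g [^] d)" by blast
  have "z \<noteq> 0"
    using z zero_power [OF d(1)] char_embedding_nonzero [OF d(2)] by metis
  then show ?thesis
  proof (rule char_embedding_adjoin [OF g])
    fix f :: int assume f: "g [^] f \<in> H"
    have dq: "g [^] (int d * q) = (g [^] d) [^] q" for q :: int
      using g by (simp add: int_pow_int flip: int_pow_pow)
    have "g [^] (f mod int d) = g [^] f \<otimes> inv (g [^] (int d * (f div int d)))"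
      by (simp only: int_pow_diff [OF g, symmetric] minus_mult_div_eq_mod)
    also have "\<dots> \<in> H"
      unfolding dq using f d subgroup_int_pow_closed [OF char_embedding_subgroup]
      by (intro subgroup.m_closed subgroup.m_inv_closed char_embedding_subgroup) auto
    also have "f mod int d = int (nat (f mod int d))"
      using d(1) by simp
    finally have "g [^] nat (f mod int d) \<in> H"
      by (simp only: int_pow_int)
    then have "nat (f mod int d) = 0"
      using least [of "nat (f mod int d)"] d(1) pos_mod_bound [of "int d" f] by linarith
    then have "f mod int d = 0"
      using d(1) pos_mod_sign [of "int d" f] by linarith
    then have f: "f = int d * (f div int d)"
      using mult_div_mod_eq [of "int d" f] by linarith
    have "\<phi> (g [^] f) = \<phi> (g [^] d) powi (f div int d)"
      by (subst f) (simp add: dq char_embedding_int_pow d)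
    also have "\<dots> = z powi f"
      by (subst (2) f) (simp add: z [symmetric] power_int_mult)
    finally show "\<phi> (g [^] f) = z powi f" .
  next
    fix x and f :: int assume x: "x \<in> H" and eq: "\<phi> x * z powi f = 1"
    note carr = char_embedding_carrier [OF x]
    have swap: "(g [^] f) [^] d = (g [^] d) [^] f"
      by (simp only: int_pow_int [symmetric] int_pow_pow [OF g] mult.commute)
    \<comment> \<open>This power lies in \<open>H\<close> and has value 1, so it is trivial and
      \<open>x \<otimes> g [^] f\<close> is torsion.\<close>
    have "(x \<otimes> g [^] f) [^] d = x [^] d \<otimes> (g [^] d) [^] f"
      using g carr by (simp add: nat_pow_distrib swap)
    moreover have "x [^] d \<in> H" "(g [^] d) [^] f \<in> H"
      using x d char_embedding_nat_pow subgroup_int_pow_closed [OF char_embedding_subgroup] by auto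
    moreover have "\<phi> (x [^] d \<otimes> (g [^] d) [^] f) = (\<phi> x * z powi f) ^ d"
    proof -
      have "\<phi> (x [^] d \<otimes> (g [^] d) [^] f) = \<phi> x ^ d * (z ^ d) powi f"
        using calculation(2,3) x d
        by (simp add: char_embedding_mult char_embedding_nat_pow char_embedding_int_pow z)
      also have "(z ^ d) powi f = (z powi f) ^ d"
        unfolding power_int_power power_int_power' by (simp only: mult.commute)
      finally show ?thesis by (simp only: power_mult_distrib)
    qed
    ultimately have "(x \<otimes> g [^] f) [^] d = \<one>"
      using eq char_embedding_eq_1 subgroup.m_closed [OF char_embedding_subgroup] by simp
    then have "x \<otimes> g [^] f \<in> H"
      using torsion d(1) g carr by (auto simp: torsion_subgroup_def)
    then have "inv x \<otimes> (x \<otimes> g [^] f) \<in> H"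
      using x subgroup.m_closed [OF char_embedding_subgroup] subgroup.m_inv_closed [OF char_embedding_subgroup]
      by blast
    moreover have "inv x \<otimes> (x \<otimes> g [^] f) = g [^] f"
      using g carr m_assoc [of "inv x" x "g [^] f"] by simp
    ultimately show "g [^] f \<in> H" by (simp only:)
  qed
next
  case False
  \<comment> \<open>Including 0 among the values rules out \<open>z = 0\<close>.\<close>
  define Z where "Z = (\<Union>r\<in>{0<..}. \<Union>y\<in>insert 0 (\<phi> ` H). {z :: complex. z ^ r = y})"
  have "finite {z :: complex. z ^ r = y}" if "r > 0" for r y
  proof (cases "y = 0")
    case False
    then show ?thesis using that by (intro finite_nth_roots)
  qed (use that in simp)
  then have "countable Z"
    unfolding Z_def using countable by (intro countable_UN countable_insert countable_image) (auto intro: countable_finite)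
  then have "Z \<noteq> UNIV"
    using uncountable_UNIV_complex by auto
  then obtain z where "z \<notin> Z" by blast
  then have z: "z ^ r \<noteq> 0" "z ^ r \<notin> \<phi> ` H" if "r > 0" for r
    using that by (auto simp: Z_def)
  have "z \<noteq> 0"
    using z(1) [of 1] by simp
  then show ?thesis
  proof (rule char_embedding_adjoin [OF g])
    fix f :: int assume f: "g [^] f \<in> H"
    have "f = 0"
    proof (cases f rule: int_cases2)
      case (nonneg r)
      then show ?thesis using False f by (auto simp: int_pow_int)
    next
      case (nonpos r)
      then have "inv (g [^] r) \<in> H"
        using f g by (simp add: int_pow_neg_int)
      then have "inv (inv (g [^] r)) \<in> H"
        by (rule subgroup.m_inv_closed [OF char_embedding_subgroup])
      then have "g [^] r \<in> H" using g by (simp only: inv_inv nat_pow_closed)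
      then show ?thesis using False nonpos by auto
    qed
    then show "\<phi> (g [^] f) = z powi f" by (simp add: char_embedding_one)
  next
    fix x and f :: int assume x: "x \<in> H" and eq: "\<phi> x * z powi f = 1"
    \<comment> \<open>A nonzero \<open>f\<close> would make a positive power of \<open>z\<close> a
      value of \<open>\<phi>\<close> on \<open>H\<close>.\<close>
    have "f = 0"
    proof (cases f rule: int_cases2)
      case (nonneg r)
      then have "z ^ r = \<phi> (inv x)"
        using eq x by (simp add: char_embedding_inv inverse_unique)
      then have "z ^ r \<in> \<phi> ` H" using x subgroup.m_inv_closed [OF char_embedding_subgroup] by auto
      then show ?thesis using z(2) nonneg by auto
    next
      case (nonpos r)
      then have "z ^ r = \<phi> x"
        using eq \<open>z \<noteq> 0\<close> by (simp add: power_int_minus field_simps)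
      then have "z ^ r \<in> \<phi> ` H" using x by auto
      then show ?thesis using z(2) nonpos by auto
    qed
    then show "g [^] f \<in> H"
      by (simp add: subgroup.one_closed [OF char_embedding_subgroup])
  qed
qed

end

section \<open>From the torsion subgroup to any finite set of elements\<close>

lemma adjoin_contains:
  assumes "H \<subseteq> carrier G" "\<one> \<in> H" "g \<in> carrier G"
  shows "H \<subseteq> adjoin G H g" "g \<in> adjoin G H g"
proof -
  have "x = x \<otimes> g [^] (0::int)" if "x \<in> H" for x using that assms by auto
  then show "H \<subseteq> adjoin G H g" unfolding adjoin_def by blast
  have "g = \<one> \<otimes> g [^] (1::int)" using assms by simp
  then show "g \<in> adjoin G H g" unfolding adjoin_def using assms by blast
qed

lemma countable_adjoin:
  assumes "countable H"
  shows "countable (adjoin G H g)"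
proof -
  have "adjoin G H g = (\<lambda>(x, f). x \<otimes> g [^] f) ` (H \<times> (UNIV :: int set))"
    by (auto simp: adjoin_def)
  then show ?thesis using assms by auto
qed

text \<open>A generator of the torsion subgroup has finite order, so the trivial embedding extends
  by sending it to a primitive root of unity of that order.\<close>

lemma torsion_char_embedding:
  assumes "cyclic_group (G\<lparr>carrier := torsion_subgroup G\<rparr>)"
  shows "countable (torsion_subgroup G) \<and> (\<exists>\<phi>. char_embedding G (torsion_subgroup G) \<phi>)"
proof -
  let ?T = "torsion_subgroup G"
  interpret T: group "G\<lparr>carrier := ?T\<rparr>"
    by (rule subgroup.subgroup_is_group [OF torsion_subgroup_is_subgroup group_axioms])
  obtain x where x: "x \<in> ?T" and range: "?T = range (\<lambda>f::int. x [^]\<^bsub>G\<lparr>carrier := ?T\<rparr>\<^esub> f)"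
    using assms by (auto simp: T.cyclic_group)
  have carr: "x \<in> carrier G" using x by (simp add: torsion_subgroup_def)
  have T: "?T = adjoin G {\<one>} x"
    using carr range by (auto simp: adjoin_def simp flip: int_pow_consistent [OF torsion_subgroup_is_subgroup x])
  have triv: "char_embedding G {\<one>} (\<lambda>_. 1)"
    by (simp add: char_embedding_def triv_subgroup)
  have "ord x \<noteq> 0"
    using x unfolding ord_eq_0 [OF carr] by (auto simp: torsion_subgroup_def)
  then have root: "cis (2 * pi / real (ord x)) powi f = 1 \<longleftrightarrow> x [^] f = \<one>" for f :: int
    using carr by (simp add: cis_root_powi_eq_1_iff int_pow_eq_id)
  have "\<exists>\<phi>. char_embedding G (adjoin G {\<one>} x) \<phi>"
    by (rule char_embedding_adjoin [OF triv carr, of "cis (2 * pi / real (ord x))"])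
       (simp_all add: root)
  then show ?thesis
    using countable_adjoin [of "{\<one>}" x] by (simp add: T)
qed

text \<open>The elements of \<open>F\<close> are adjoined one by one to the torsion subgroup. The
  induction carries countability and containment of the torsion subgroup, which each extension
  requires.\<close>

lemma finite_subset_char_embedding:
  assumes cyclic: "cyclic_group (G\<lparr>carrier := torsion_subgroup G\<rparr>)"
    and "finite F" "F \<subseteq> carrier G"
  obtains H \<phi> where "char_embedding G H \<phi>" "F \<subseteq> H"
proof -
  have "\<exists>H \<phi>. char_embedding G H \<phi> \<and> countable H \<and> torsion_subgroup G \<subseteq> H \<and> F \<subseteq> H"
    using assms(2,3)
  proof (induction rule: finite_induct)
    case empty
    obtain \<phi> where "countable (torsion_subgroup G)" "char_embedding G (torsion_subgroup G) \<phi>"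
      using torsion_char_embedding [OF cyclic] by (elim conjE exE)
    then show ?case
      by (intro exI [of _ "torsion_subgroup G"] exI [of _ \<phi>]) simp
  next
    case (insert g F)
    then obtain H \<phi> where H: "char_embedding G H \<phi>" "countable H" "torsion_subgroup G \<subseteq> H" "F \<subseteq> H"
      by auto
    then have "subgroup H G" by (simp add: char_embedding_def)
    moreover have "g \<in> carrier G" using insert.prems by simp
    ultimately have "H \<subseteq> adjoin G H g" "g \<in> adjoin G H g"
      using adjoin_contains [of H g] by (simp_all add: subgroup.subset subgroup.one_closed)
    moreover obtain \<psi> where "char_embedding G (adjoin G H g) \<psi>"
      using char_embedding_extend [OF H(1) \<open>g \<in> carrier G\<close> H(2,3)] by (elim exE)
    moreover have "countable (adjoin G H g)"
      by (rule countable_adjoin [OF H(2)])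
    moreover have "torsion_subgroup G \<subseteq> adjoin G H g"
      using H(3) calculation(1) by (rule order_trans)
    moreover have "insert g F \<subseteq> adjoin G H g"
      using H(4) calculation(1,2) by (simp add: order_trans)
    ultimately show ?case
      by (intro exI [of _ "adjoin G H g"] exI [of _ \<psi>] conjI)
  qed
  then show thesis by (elim exE conjE) (rule that)
qed

end

section \<open>Restricted sumsets\<close>

lemma finite_subset_list_of_length:
  assumes "finite Y" "card Y \<le> r"
  obtains ys where "length ys = r" "Y \<subseteq> set ys"
proof -
  obtain zs where zs: "set zs = Y" "distinct zs"
    using finite_distinct_list [OF assms(1)] by blast
  have "length zs = card Y"
    using distinct_card [OF zs(2)] zs(1) by simp
  then show thesis
    using assms(2) zs(1) by (intro that [of "zs @ replicate (r - card Y) undefined"]) auto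
qed

text \<open>Padding to the exact length makes the degree critical: the two determinants contribute
  \<open>(m + 1) * (n choose 2)\<close> and each linear factor contributes 1. Padding values merely
  add sums to avoid.\<close>

lemma avoidance_list:
  fixes f :: "'a set \<Rightarrow> 'b"
  assumes "finite S" "k > 0" "int (card S) \<le> (int k - 1) * int n - (int m + 1) * int (n choose 2)"
  obtains ss where "length ss + (m + 1) * (n choose 2) = n * (k - 1)" "f ` S \<subseteq> set ss"
proof -
  \<comment> \<open>The bound is at least \<open>card S\<close>, hence nonnegative, so
    \<open>nat\<close> loses nothing.\<close>
  define r where "r = nat ((int k - 1) * int n - (int m + 1) * int (n choose 2))"
  have r: "int r = (int k - 1) * int n - (int m + 1) * int (n choose 2)" "card S \<le> r"
    using assms(3) by (auto simp: r_def)
  have "finite (f ` S)" "card (f ` S) \<le> r"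
    using r(2) card_image_le [OF assms(1), of f] assms(1) by simp_all
  then obtain ss where "length ss = r" "f ` S \<subseteq> set ss"
    by (rule finite_subset_list_of_length)
  moreover have "int (r + (m + 1) * (n choose 2)) = int (n * (k - 1))"
    using r(1) assms(2) by (simp add: of_nat_diff algebra_simps)
  ultimately show thesis
    by (intro that [of ss]) (simp_all only: of_nat_eq_iff)
qed

theorem theorem1p3:
  fixes G (structure)
    and h k l m n :: nat
    and c :: "nat \<Rightarrow> 'a"
    and A B :: "nat \<Rightarrow> 'a set"
    and S T :: "'a set set"
  assumes "comm_group G"
    and "cyclic_group (G\<lparr>carrier := torsion_subgroup G\<rparr>)"
    and "h > 0" "k > 0" "l > 0" "m > 0" "n > 0"
    and "int k - 1 \<ge> int m * (int n - 1)"
    and "int l - 1 \<ge> int h * (int n - 1)"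
    and "\<And>i. i \<in> {1..n} \<Longrightarrow> c i \<in> carrier G"
    and "inj_on c {1..n}"
    and "\<And>i. i \<in> {1..n} \<Longrightarrow> A i \<subseteq> carrier G \<and> finite (A i) \<and> card (A i) = k"
    and "\<And>i. i \<in> {1..n} \<Longrightarrow> B i \<subseteq> carrier G \<and> finite (B i) \<and> card (B i) = l"
    and "finite S"
    and "int (card S) \<le> (int k - 1) * int n - (int m + 1) * int (n choose 2)"
    and "finite T"
    and "int (card T) \<le> (int l - 1) * int n - (int h + 1) * int (n choose 2)"
  shows "\<exists>a b. (\<forall>i\<in>{1..n}. a i \<in> A i) \<and> (\<forall>i\<in>{1..n}. b i \<in> B i) \<and>
           a ` {1..n} \<notin> S \<and> b ` {1..n} \<notin> T \<and>
           (\<forall>i\<in>{1..n}. \<forall>j\<in>{1..n}. i < j \<longrightarrow>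
              a i \<otimes> b i \<otimes> c i \<noteq> a j \<otimes> b j \<otimes> c j \<and>
              a i [^] m \<noteq> a j [^] m \<and>
              b i [^] h \<noteq> b j [^] h)"
proof -
  interpret comm_group G by fact
  define F where "F = (\<Union>i\<in>{1..n}. A i) \<union> (\<Union>i\<in>{1..n}. B i) \<union> c ` {1..n}"
  have "finite F"
    using assms(12,13) by (simp add: F_def)
  moreover have "F \<subseteq> carrier G"
    unfolding F_def using assms(10,12,13) by (intro Un_least UN_least image_subsetI) blast+
  ultimately obtain H \<phi> where emb: "char_embedding G H \<phi>" and "F \<subseteq> H"
    by (rule finite_subset_char_embedding [OF assms(2)])
  then have AH: "A i \<subseteq> H" and BH: "B i \<subseteq> H" and cH: "c i \<in> H" if "i \<in> {1..n}" for i
    using that unfolding F_def by blast+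
  have inj: "inj_on \<phi> Y" if "Y \<subseteq> H" for Y
    using char_embedding_inj [OF emb] that by (rule inj_on_subset)
  \<comment> \<open>\<open>Suc\<close> passes from the grid indices \<open>{0..<n}\<close> to the
    indices \<open>{1..n}\<close>.\<close>
  have grid: "finite (\<phi> ` A (Suc i)) \<and> card (\<phi> ` A (Suc i)) = k"
    "finite (\<phi> ` B (Suc i)) \<and> card (\<phi> ` B (Suc i)) = l" if "i < n" for i
  proof -
    have "Suc i \<in> {1..n}" using that by simp
    note i = assms(12) [OF this] assms(13) [OF this] inj [OF AH [OF this]] inj [OF BH [OF this]]
    show "finite (\<phi> ` A (Suc i)) \<and> card (\<phi> ` A (Suc i)) = k"
      "finite (\<phi> ` B (Suc i)) \<and> card (\<phi> ` B (Suc i)) = l"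
      using i(1,2) card_image [OF i(3)] card_image [OF i(4)] by simp_all
  qed
  have "int (m * (n - 1)) < int k" "int (h * (n - 1)) < int l"
    using assms(7,8,9) by (simp_all add: of_nat_diff)
  then have bound: "m * (n - 1) < k" "h * (n - 1) < l"
    by (simp_all only: of_nat_less_iff)
  \<comment> \<open>Sets are excluded through their element sums: a set whose sum differs from those
    of all members of \<open>S\<close> is not in \<open>S\<close>.\<close>
  define \<sigma> where "\<sigma> = (\<lambda>s. \<Sum>u\<in>s. \<phi> u)"
  obtain ss where ss: "length ss + (m + 1) * (n choose 2) = n * (k - 1)" "\<sigma> ` S \<subseteq> set ss"
    by (rule avoidance_list [OF assms(14,4,15)])
  obtain ts where ts: "length ts + (h + 1) * (n choose 2) = n * (l - 1)" "\<sigma> ` T \<subseteq> set ts"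
    by (rule avoidance_list [OF assms(16,5,17)])
  have inj_c: "inj_on (\<lambda>i. \<phi> (c (Suc i))) {0..<n}"
  proof (rule inj_onI)
    fix i j assume "i \<in> {0..<n}" "j \<in> {0..<n}" "\<phi> (c (Suc i)) = \<phi> (c (Suc j))"
    then have "c (Suc i) = c (Suc j)"
      using char_embedding_inj [OF emb] cH by (simp add: inj_on_eq_iff)
    then show "i = j"
      using assms(11) \<open>i \<in> {0..<n}\<close> \<open>j \<in> {0..<n}\<close> by (simp add: inj_on_eq_iff)
  qed
  obtain x y where x: "x \<in> PiE {0..<n} (\<lambda>i. \<phi> ` A (Suc i))" and y: "y \<in> PiE {0..<n} (\<lambda>i. \<phi> ` B (Suc i))"
    and inj_sums: "inj_on (\<lambda>i. \<phi> (c (Suc i)) * x i * y i) {0..<n}"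
    and inj_x: "inj_on (\<lambda>i. x i ^ m) {0..<n}" and inj_y: "inj_on (\<lambda>i. y i ^ h) {0..<n}"
    and sum_x: "(\<Sum>i = 0..<n. x i) \<notin> set ss" and sum_y: "(\<Sum>i = 0..<n. y i) \<notin> set ts"
    by (rule grid_point_nonvanishing [OF grid inj_c assms(6) bound(1) assms(3) bound(2) ss(1) ts(1)])
  define a where "a = (\<lambda>i. inv_into (A i) \<phi> (x (i - 1)))"
  define b where "b = (\<lambda>i. inv_into (B i) \<phi> (y (i - 1)))"
  have a: "a i \<in> A i" "\<phi> (a i) = x (i - 1)" and b: "b i \<in> B i" "\<phi> (b i) = y (i - 1)"
    if "i \<in> {1..n}" for i
  proof -
    have i: "i - 1 \<in> {0..<n}" "Suc (i - 1) = i" using that by auto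
    have "x (i - 1) \<in> \<phi> ` A i" "y (i - 1) \<in> \<phi> ` B i"
      using PiE_mem [OF x i(1)] PiE_mem [OF y i(1)] i(2) by simp_all
    then show "a i \<in> A i" "\<phi> (a i) = x (i - 1)" "b i \<in> B i" "\<phi> (b i) = y (i - 1)"
      by (simp_all add: a_def b_def inv_into_into f_inv_into_f)
  qed
  have aH: "a i \<in> H" and bH: "b i \<in> H" if "i \<in> {1..n}" for i
    using a b AH BH that by blast+
  have eqI: "i = j"
    if ij: "i \<in> {1..n}" "j \<in> {1..n}" and "inj_on f {0..<n}" "f (i - 1) = f (j - 1)"
    for i j and f :: "nat \<Rightarrow> complex"
  proof -
    have "i - 1 = j - 1"
      using inj_onD [OF that(3,4)] ij by auto
    then show ?thesis using ij by auto
  qed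
  \<comment> \<open>Distinct \<open>m\<close>-th powers force distinct elements, so the sum over the
    set of the \<open>a i\<close> counts each index once.\<close>
  have inj_a: "inj_on a {1..n}"
  proof (rule inj_onI)
    fix i j assume "i \<in> {1..n}" "j \<in> {1..n}" "a i = a j"
    then show "i = j"
      using eqI [OF _ _ inj_x, of i j] a(2) [of i] a(2) [of j] by simp
  qed
  have inj_b: "inj_on b {1..n}"
  proof (rule inj_onI)
    fix i j assume "i \<in> {1..n}" "j \<in> {1..n}" "b i = b j"
    then show "i = j"
      using eqI [OF _ _ inj_y, of i j] b(2) [of i] b(2) [of j] by simp
  qed
  have shift: "(\<Sum>i = 0..<n. f i) = (\<Sum>i\<in>{1..n}. f (i - 1))" for f :: "nat \<Rightarrow> complex"
    by (rule sum.reindex_bij_witness [of _ "\<lambda>i. i - 1" Suc]) auto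
  have "a ` {1..n} \<notin> S"
  proof
    assume "a ` {1..n} \<in> S"
    moreover have "\<sigma> (a ` {1..n}) = (\<Sum>i = 0..<n. x i)"
      unfolding \<sigma>_def shift sum.reindex [OF inj_a] by (rule sum.cong) (simp_all add: a)
    ultimately show False using ss(2) sum_x by (metis image_subset_iff)
  qed
  moreover have "b ` {1..n} \<notin> T"
  proof
    assume "b ` {1..n} \<in> T"
    moreover have "\<sigma> (b ` {1..n}) = (\<Sum>i = 0..<n. y i)"
      unfolding \<sigma>_def shift sum.reindex [OF inj_b] by (rule sum.cong) (simp_all add: b)
    ultimately show False using ts(2) sum_y by (metis image_subset_iff)
  qed
  moreover have "a i \<otimes> b i \<otimes> c i \<noteq> a j \<otimes> b j \<otimes> c j \<and> a i [^] m \<noteq> a j [^] m \<and> b i [^] h \<noteq> b j [^] h"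
    if ij: "i \<in> {1..n}" "j \<in> {1..n}" "i < j" for i j
  proof (intro conjI notI)
    have \<phi>: "\<phi> (a r \<otimes> b r \<otimes> c r) = \<phi> (c (Suc (r - 1))) * x (r - 1) * y (r - 1)" if "r \<in> {1..n}" for r
    proof -
      have "a r \<otimes> b r \<in> H"
        using subgroup.m_closed [OF char_embedding_subgroup [OF emb]] aH bH that by blast
      moreover have "Suc (r - 1) = r" using that by auto
      ultimately show ?thesis
        using a(2) [OF that] b(2) [OF that] aH [OF that] bH [OF that] cH [OF that]
        by (simp add: char_embedding_mult [OF emb])
    qed
    assume "a i \<otimes> b i \<otimes> c i = a j \<otimes> b j \<otimes> c j"
    then show False
      using eqI [OF ij(1,2) inj_sums] \<phi> [OF ij(1)] \<phi> [OF ij(2)] ij(3) by simp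
  next
    assume "a i [^] m = a j [^] m"
    then have "x (i - 1) ^ m = x (j - 1) ^ m"
      using char_embedding_nat_pow [OF emb aH [OF ij(1)], of m] char_embedding_nat_pow [OF emb aH [OF ij(2)], of m]
        a(2) [OF ij(1)] a(2) [OF ij(2)] by simp
    then show False using eqI [OF ij(1,2) inj_x] ij(3) by simp
  next
    assume "b i [^] h = b j [^] h"
    then have "y (i - 1) ^ h = y (j - 1) ^ h"
      using char_embedding_nat_pow [OF emb bH [OF ij(1)], of h] char_embedding_nat_pow [OF emb bH [OF ij(2)], of h]
        b(2) [OF ij(1)] b(2) [OF ij(2)] by simp
    then show False using eqI [OF ij(1,2) inj_y] ij(3) by simp
  qed
  ultimately show ?thesis
    using a(1) b(1) by (intro exI [of _ a] exI [of _ b] conjI ballI impI) blast+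
qed

end
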